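(* Let $H$ be a complex Hilbert space, let $A=A^*$ be an unbounded selfadjoint operator in $H$ with null space $N:=N(A)$, let $a>0$ be a constant, and let $f\in H$ be such that the equation $Au=f$ is solvable. Let $y$ be the minimal-norm solution of $Au=f$, i.e. the unique solution with $y\perp N$. Let $u_1\in H$ be any element with $u_1\perp N$, and define $$u_{n+1}=Lu_n+g,\quad n\ge 1,\qquad L:=ia(A+iaI)^{-1},\qquad g:=(A+iaI)^{-1}f.$$ Then $$\lim_{n\to\infty}\|u_n-y\|=0.$$
   Context: $I$ is the identity operator and $i$ is the imaginary unit. The operator $A$ need not be injective and its range need not be closed. *)

theory Defs
  imports "HOL-Analysis.Analysis"
begin

class complex_vector = real_vector +
  fixes scaleC :: "complex \<Rightarrow> 'a \<Rightarrow> 'a"  (infixr "*\<^sub>C" 75)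
  assumes scaleC_add_right: "c *\<^sub>C (x + y) = c *\<^sub>C x + c *\<^sub>C y"
    and scaleC_add_left: "(c + d) *\<^sub>C x = c *\<^sub>C x + d *\<^sub>C x"
    and scaleC_scaleC: "c *\<^sub>C d *\<^sub>C x = (c * d) *\<^sub>C x"
    and scaleC_one: "1 *\<^sub>C x = x"
    and scaleR_scaleC: "r *\<^sub>R x = complex_of_real r *\<^sub>C x"

text \<open>The complex inner product is linear in its first argument. Its positive definiteness and
  the identity norm x = sqrt (Re (cinner x x)) are inherited from \<^class>\<open>real_inner\<close>, because
  the real inner product is required to be the real part of the complex one.\<close>

class complex_inner = complex_vector + real_inner +
  fixes cinner :: "'a \<Rightarrow> 'a \<Rightarrow> complex"
  assumes cinner_commute: "cinner x y = cnj (cinner y x)"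
    and cinner_add_left: "cinner (x + y) z = cinner x z + cinner y z"
    and cinner_scaleC_left: "cinner (c *\<^sub>C x) y = c * cinner x y"
    and inner_eq_Re_cinner: "x \<bullet> y = Re (cinner x y)"

class complex_hilbert_space = complex_inner + complete_space

text \<open>A possibly unbounded operator is given by its domain \<open>D\<close> and a total function \<open>A\<close>
  of which only the values on \<open>D\<close> matter.\<close>

definition linear_operator_on :: "'a::complex_vector set \<Rightarrow> ('a \<Rightarrow> 'a) \<Rightarrow> bool" where
  "linear_operator_on D A \<longleftrightarrow>
     0 \<in> D \<and>
     (\<forall>x\<in>D. \<forall>y\<in>D. x + y \<in> D \<and> A (x + y) = A x + A y) \<and>
     (\<forall>c. \<forall>x\<in>D. c *\<^sub>C x \<in> D \<and> A (c *\<^sub>C x) = c *\<^sub>C A x)"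

definition adjoint_domain :: "'a::complex_inner set \<Rightarrow> ('a \<Rightarrow> 'a) \<Rightarrow> 'a set" where
  "adjoint_domain D A = {y. \<exists>z. \<forall>x\<in>D. cinner (A x) y = cinner x z}"

text \<open>The vector described here is unique if \<open>D\<close> is dense and \<open>y\<close> lies in the domain of the
  adjoint.\<close>

definition adjoint_operator :: "'a::complex_inner set \<Rightarrow> ('a \<Rightarrow> 'a) \<Rightarrow> 'a \<Rightarrow> 'a" where
  "adjoint_operator D A y = (THE z. \<forall>x\<in>D. cinner (A x) y = cinner x z)"

definition selfadjoint_on :: "'a::complex_inner set \<Rightarrow> ('a \<Rightarrow> 'a) \<Rightarrow> bool" where
  "selfadjoint_on D A \<longleftrightarrow>
     linear_operator_on D A \<and> closure D = UNIV \<and>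
     adjoint_domain D A = D \<and> (\<forall>x\<in>D. adjoint_operator D A x = A x)"

definition null_space :: "'a::complex_inner set \<Rightarrow> ('a \<Rightarrow> 'a) \<Rightarrow> 'a set" where
  "null_space D A = {x \<in> D. A x = 0}"

definition orthogonal_to :: "'a::complex_inner \<Rightarrow> 'a set \<Rightarrow> bool" where
  "orthogonal_to x S \<longleftrightarrow> (\<forall>v\<in>S. cinner x v = 0)"

text \<open>For selfadjoint \<open>A\<close> the null space is a closed subspace and the solution set is a translate
  of it, so the solution of least norm is the one orthogonal to the null space.\<close>

definition minimal_norm_solution :: "'a::complex_inner set \<Rightarrow> ('a \<Rightarrow> 'a) \<Rightarrow> 'a \<Rightarrow> 'a" where
  "minimal_norm_solution D A f =
     (THE y. y \<in> D \<and> A y = f \<and> orthogonal_to y (null_space D A))"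

text \<open>The inverse of \<open>A + c I\<close>, an operator with domain \<open>D\<close>. The use of \<^const>\<open>inv_into\<close> is
  meaningful when \<open>A + c I\<close> is a bijection from \<open>D\<close> onto the whole space, as is the case for
  selfadjoint \<open>A\<close> and non-real \<open>c\<close>.\<close>

definition shifted_inverse ::
    "'a::complex_vector set \<Rightarrow> ('a \<Rightarrow> 'a) \<Rightarrow> complex \<Rightarrow> 'a \<Rightarrow> 'a" where
  "shifted_inverse D A c = inv_into D (\<lambda>x. A x + c *\<^sub>C x)"

end

theory Submission
  imports Defs
begin

text \<open>Every \<open>x\<close> has the form \<open>A v + \<i> a v\<close> with \<open>v \<in> D\<close>. Then \<open>L x = \<i> a v\<close> and \<open>x - L x = A v\<close>, and
  symmetry of \<open>A\<close> gives the Pythagorean identity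
  \<open>\<parallel>x\<parallel>\<^sup>2 = \<parallel>L x\<parallel>\<^sup>2 + \<parallel>x - L x\<parallel>\<^sup>2\<close>. So \<open>\<parallel>L\<^sup>n x\<parallel>\<close> decreases, and the differences
  \<open>L\<^sup>n x - L\<^sup>n\<^sup>+\<^sup>1 x = L\<^sup>n (x - L x)\<close> tend to \<open>0\<close>: the powers of \<open>L\<close> tend to \<open>0\<close> on the range of \<open>A\<close>.
  As \<open>L\<close> is a contraction, they tend to \<open>0\<close> on the closure of the range of \<open>A\<close>, which
  is the orthogonal complement of the null space. Finally \<open>u\<^sub>n - y = L\<^sup>n\<^sup>-\<^sup>1 (u\<^sub>1 - y)\<close>. No spectral theorem is
  needed.\<close>

section \<open>Orthogonal projection onto a closed subspace\<close>

lemma parallelogram_law: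
  fixes x y :: "'a::real_inner"
  shows "(norm (x + y))\<^sup>2 + (norm (x - y))\<^sup>2 = 2 * (norm x)\<^sup>2 + 2 * (norm y)\<^sup>2"
  by (simp add: power2_norm_eq_inner inner_simps inner_commute)

text \<open>Completeness stands in for compactness: by the parallelogram law and convexity, a
  minimizing sequence is Cauchy, and its limit stays in the closed set.\<close>

lemma closest_point_exists_complete:
  fixes S :: "'a::{real_inner, complete_space} set"
  assumes "closed S" "convex S" "S \<noteq> {}"
  shows "\<exists>p\<in>S. \<forall>s\<in>S. dist x p \<le> dist x s"
proof -
  let ?d = "infdist x S"
  have "\<exists>s\<in>S. dist x s < ?d + inverse (real (Suc n))" for n
  proof (rule ccontr)
    assume "\<not> ?thesis"
    then have "?d + inverse (real (Suc n)) \<le> ?d"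
      unfolding infdist_notempty[OF assms(3)]
      by (intro cINF_greatest[OF assms(3)]) (auto simp: not_less)
    then show False
      by (simp add: not_le[symmetric])
  qed
  then obtain s where s: "\<And>n. s n \<in> S" "\<And>n. dist x (s n) < ?d + inverse (real (Suc n))"
    by metis
  have dn: "?d \<le> dist x t" if "t \<in> S" for t
    using that by (rule infdist_le)
  have lim: "(\<lambda>n. dist x (s n)) \<longlonglongrightarrow> ?d"
  proof (rule tendsto_sandwich[of "\<lambda>_. ?d" _ _ "\<lambda>n. ?d + inverse (real (Suc n))"])
    show "(\<lambda>n. ?d + inverse (real (Suc n))) \<longlonglongrightarrow> ?d"
      using tendsto_add[OF tendsto_const LIMSEQ_inverse_real_of_nat] by auto
    show "\<forall>\<^sub>F n in sequentially. dist x (s n) \<le> ?d + inverse (real (Suc n))"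
      using s(2) by (intro always_eventually allI less_imp_le)
  qed (use dn s(1) in auto)
  \<comment> \<open>The midpoint of \<open>s m\<close> and \<open>s n\<close> lies in
    \<open>S\<close>, so the sum of \<open>x - s m\<close> and \<open>x - s n\<close> has norm at
    least \<open>2 * ?d\<close>; the parallelogram law then bounds their difference.\<close>
  have par: "(dist (s m) (s n))\<^sup>2 \<le> 2 * (dist x (s m))\<^sup>2 + 2 * (dist x (s n))\<^sup>2 - 4 * ?d\<^sup>2" for m n
  proof -
    have "(1/2) *\<^sub>R s m + (1/2) *\<^sub>R s n \<in> S"
      using assms(2) s by (intro convexD) auto
    then have "?d \<le> dist x ((1/2) *\<^sub>R s m + (1/2) *\<^sub>R s n)"
      by (rule dn)
    also have "\<dots> = norm ((1/2) *\<^sub>R ((x - s m) + (x - s n)))"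
      by (simp add: dist_norm algebra_simps flip: scaleR_add_left)
    finally have "2 * ?d \<le> norm ((x - s m) + (x - s n))"
      by simp
    then have "(2 * ?d)\<^sup>2 \<le> (norm ((x - s m) + (x - s n)))\<^sup>2"
      by (intro power_mono) (auto simp: infdist_nonneg)
    moreover have "dist (s m) (s n) = norm ((x - s m) - (x - s n))"
      by (simp add: dist_norm norm_minus_commute)
    ultimately show ?thesis
      using parallelogram_law[of "x - s m" "x - s n"] by (simp add: dist_norm power_mult_distrib)
  qed
  have "Cauchy s"
  proof (rule metric_CauchyI)
    fix e :: real assume "e > 0"
    have "(\<lambda>n. (dist x (s n))\<^sup>2) \<longlonglongrightarrow> ?d\<^sup>2"
      by (intro tendsto_intros lim)
    \<comment> \<open>The slack \<open>e\<^sup>2 / 4\<close> enters \<open>par\<close> twice with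
      factor 2, which adds up to \<open>e\<^sup>2\<close>.\<close>
    then have "\<forall>\<^sub>F n in sequentially. (dist x (s n))\<^sup>2 < ?d\<^sup>2 + e\<^sup>2 / 4"
      by (rule order_tendstoD) (use \<open>e > 0\<close> in simp)
    then obtain N where N: "\<And>n. n \<ge> N \<Longrightarrow> (dist x (s n))\<^sup>2 < ?d\<^sup>2 + e\<^sup>2 / 4"
      by (auto simp: eventually_sequentially)
    have "dist (s m) (s n) < e" if "m \<ge> N" "n \<ge> N" for m n
    proof -
      have "(dist (s m) (s n))\<^sup>2 < e\<^sup>2"
        using par[of m n] N[OF that(1)] N[OF that(2)] by linarith
      then show ?thesis
        using \<open>e > 0\<close> by (simp add: power_less_imp_less_base)
    qed
    then show "\<exists>M. \<forall>m\<ge>M. \<forall>n\<ge>M. dist (s m) (s n) < e"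
      by blast
  qed
  then obtain p where p: "s \<longlonglongrightarrow> p"
    using Cauchy_convergent convergent_def by blast
  have "p \<in> S"
    using assms(1) s p closed_sequentially by blast
  moreover have "dist x p = ?d"
    using LIMSEQ_unique[OF lim tendsto_dist[OF tendsto_const p]] by simp
  ultimately show ?thesis
    using dn by metis
qed

text \<open>First variation at the closest point: if the residual had a component along
  \<open>s\<close>, moving along \<open>s\<close> would come closer to \<open>x\<close>.\<close>

lemma orthogonal_projection_exists:
  fixes S :: "'a::{real_inner, complete_space} set"
  assumes "closed S" "subspace S"
  shows "\<exists>p\<in>S. \<forall>s\<in>S. s \<bullet> (x - p) = 0"
proof -
  obtain p where p: "p \<in> S" "\<And>s. s \<in> S \<Longrightarrow> dist x p \<le> dist x s"
    using closest_point_exists_complete[OF assms(1) subspace_imp_convex[OF assms(2)]]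
      subspace_0[OF assms(2)] by blast
  have "s \<bullet> (x - p) = 0" if "s \<in> S" for s
  proof (cases "s = 0")
    case False
    \<comment> \<open>The minimizer of the quadratic
      \<open>norm (x - p - t *\<^sub>R s)\<^sup>2\<close> in \<open>t\<close>.\<close>
    define t where "t = (s \<bullet> (x - p)) / (s \<bullet> s)"
    have "p + t *\<^sub>R s \<in> S"
      using that p(1) assms(2) by (simp add: subspace_add subspace_scale)
    then have "(norm (x - p))\<^sup>2 \<le> (norm (x - p - t *\<^sub>R s))\<^sup>2"
      using p(2) by (fastforce simp: dist_norm diff_diff_eq)
    also have "\<dots> = (norm (x - p))\<^sup>2 - (s \<bullet> (x - p))\<^sup>2 / (s \<bullet> s)"
      using False unfolding power2_norm_eq_inner inner_diff_left[of "x - p"] inner_diff_right[of _ "x - p"]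
      by (simp add: t_def inner_commute power2_eq_square field_simps)
    finally have "(s \<bullet> (x - p))\<^sup>2 / (s \<bullet> s) \<le> 0"
      by simp
    moreover have "s \<bullet> s > 0"
      using False by simp
    ultimately show ?thesis
      by (simp add: divide_le_0_iff)
  qed simp
  then show ?thesis
    using p(1) by blast
qed

lemma subspace_closure:
  fixes S :: "'a::real_normed_vector set"
  assumes "subspace S"
  shows "subspace (closure S)"
proof (rule subspaceI)
  show "0 \<in> closure S"
    using subspace_0[OF assms] closure_subset by blast
  fix x y and c :: real
  assume "x \<in> closure S"
  then obtain s where s: "\<And>n. s n \<in> S" "s \<longlonglongrightarrow> x"
    unfolding closure_sequential by blast
  then have "(\<lambda>n. c *\<^sub>R s n) \<longlonglongrightarrow> c *\<^sub>R x" "\<And>n. c *\<^sub>R s n \<in> S"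
    using subspace_scale[OF assms] by (auto intro: tendsto_intros)
  then show "c *\<^sub>R x \<in> closure S"
    unfolding closure_sequential by (intro exI[of _ "\<lambda>n. c *\<^sub>R s n"]) blast
  assume "y \<in> closure S"
  then obtain t where t: "\<And>n. t n \<in> S" "t \<longlonglongrightarrow> y"
    unfolding closure_sequential by blast
  then have "(\<lambda>n. s n + t n) \<longlonglongrightarrow> x + y" "\<And>n. s n + t n \<in> S"
    using s subspace_add[OF assms] by (auto intro: tendsto_intros)
  then show "x + y \<in> closure S"
    unfolding closure_sequential by (intro exI[of _ "\<lambda>n. s n + t n"]) blast
qed

section \<open>Complex inner product spaces\<close>

lemma cinner_add_right: "cinner x (y + z) = cinner x y + cinner x (z::'a::complex_inner)"
  by (metis cinner_add_left cinner_commute complex_cnj_add)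

lemma cinner_scaleC_right: "cinner x (c *\<^sub>C y) = cnj c * cinner x (y::'a::complex_inner)"
  by (metis cinner_commute cinner_scaleC_left complex_cnj_mult)

lemma cinner_zero_right [simp]: "cinner x (0::'a::complex_inner) = 0"
  using cinner_add_right[of x 0 0] by simp

lemma cinner_diff_left: "cinner (x - y) z = cinner x z - cinner y (z::'a::complex_inner)"
  using cinner_add_left[of "x - y" y z] by simp

lemma cinner_diff_right: "cinner x (y - z) = cinner x y - cinner x (z::'a::complex_inner)"
  using cinner_add_right[of x "y - z" z] by simp

lemma cinner_self: "cinner x x = complex_of_real ((norm (x::'a::complex_inner))\<^sup>2)"
proof (rule complex_eqI)
  show "Im (cinner x x) = Im (complex_of_real ((norm x)\<^sup>2))"
    using arg_cong[OF cinner_commute[of x x], of Im] by simp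
qed (simp add: power2_norm_eq_inner inner_eq_Re_cinner)

lemma norm_scaleC: "norm (c *\<^sub>C x) = cmod c * norm (x::'a::complex_inner)"
proof -
  have "cinner (c *\<^sub>C x) (c *\<^sub>C x) = (c * cnj c) * cinner x x"
    by (simp add: cinner_scaleC_left cinner_scaleC_right)
  then have "complex_of_real ((norm (c *\<^sub>C x))\<^sup>2) = complex_of_real ((cmod c * norm x)\<^sup>2)"
    unfolding complex_norm_square[symmetric] cinner_self by (simp add: power_mult_distrib)
  then have "(norm (c *\<^sub>C x))\<^sup>2 = (cmod c * norm x)\<^sup>2"
    by (simp only: of_real_eq_iff)
  then show ?thesis
    by (simp add: power2_eq_iff_nonneg)
qed

lemma scaleC_minus_one: "(- 1) *\<^sub>C x = - (x::'a::complex_vector)"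
  using scaleR_scaleC[of "-1" x] by simp

lemma scaleC_diff_right: "c *\<^sub>C (x - y) = c *\<^sub>C x - c *\<^sub>C (y::'a::complex_vector)"
  using scaleC_add_right[of c "x - y" y] by simp

text \<open>Recovers the complex inner product from the real one, so that limits and orthogonality
  transfer from the real theory.\<close>

lemma cinner_eq_inner:
  "cinner x y = Complex (x \<bullet> y) ((- \<i> *\<^sub>C x) \<bullet> (y::'a::complex_inner))"
  by (rule complex_eqI) (simp_all add: inner_eq_Re_cinner cinner_scaleC_left)

lemma tendsto_cinner_right:
  assumes "(f \<longlongrightarrow> l) F"
  shows "((\<lambda>n. cinner x (f n)) \<longlongrightarrow> cinner x (l::'a::complex_inner)) F"
  unfolding cinner_eq_inner by (intro tendsto_Complex tendsto_intros assms)

text \<open>Together with \<open>s\<close> the set contains \<open>- \<i> *\<^sub>C s\<close>, and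
  real orthogonality to that vector kills the imaginary part.\<close>

lemma cinner_eq_zeroI:
  assumes "\<And>c s. s \<in> S \<Longrightarrow> c *\<^sub>C s \<in> S" and "\<And>s. s \<in> S \<Longrightarrow> s \<bullet> x = 0" and "s \<in> S"
  shows "cinner s (x::'a::complex_inner) = 0"
  unfolding cinner_eq_inner using assms by (simp add: complex_eq_iff)

lemma complex_orthogonal_projection_exists:
  fixes S :: "'a::complex_hilbert_space set"
  assumes "closed S" "subspace S" "\<And>c s. s \<in> S \<Longrightarrow> c *\<^sub>C s \<in> S"
  shows "\<exists>p\<in>S. \<forall>s\<in>S. cinner s (x - p) = 0"
  using orthogonal_projection_exists[OF assms(1,2), of x] cinner_eq_zeroI[OF assms(3)] by metis

lemma cinner_dense_cancel:
  assumes "closure D = UNIV" and "\<And>x. x \<in> D \<Longrightarrow> cinner x z = cinner x (w::'a::complex_inner)"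
  shows "z = w"
proof -
  have "closed {x. x \<bullet> (z - w) = 0}"
    by (intro closed_Collect_eq continuous_intros)
  moreover have "D \<subseteq> {x. x \<bullet> (z - w) = 0}"
    using assms(2) by (auto simp: inner_eq_Re_cinner cinner_diff_right)
  ultimately have "closure D \<subseteq> {x. x \<bullet> (z - w) = 0}"
    by (rule closure_minimal[rotated])
  then have "(z - w) \<bullet> (z - w) = 0"
    using assms(1) by blast
  then show ?thesis
    by simp
qed

section \<open>Selfadjoint operators\<close>

lemma linear_operator_onD:
  assumes "linear_operator_on D A"
  shows "0 \<in> D" "A 0 = 0"
    and "x \<in> D \<Longrightarrow> y \<in> D \<Longrightarrow> x + y \<in> D" "x \<in> D \<Longrightarrow> y \<in> D \<Longrightarrow> A (x + y) = A x + A y"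
    and "x \<in> D \<Longrightarrow> y \<in> D \<Longrightarrow> x - y \<in> D" "x \<in> D \<Longrightarrow> y \<in> D \<Longrightarrow> A (x - y) = A x - A y"
    and "x \<in> D \<Longrightarrow> c *\<^sub>C x \<in> D" "x \<in> D \<Longrightarrow> A (c *\<^sub>C x) = c *\<^sub>C A x"
proof -
  note lin = assms[unfolded linear_operator_on_def]
  show "0 \<in> D"
    using lin by blast
  show "A 0 = 0"
    using lin by (metis add.right_neutral add_left_cancel)
  show add: "x + y \<in> D" "A (x + y) = A x + A y" if "x \<in> D" "y \<in> D" for x y
    using lin that by blast+
  show scale: "c *\<^sub>C x \<in> D" "A (c *\<^sub>C x) = c *\<^sub>C A x" if "x \<in> D" for c x
    using lin that by blast+
  show "x - y \<in> D" "A (x - y) = A x - A y" if "x \<in> D" "y \<in> D"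
    using add[OF that(1) scale(1)[OF that(2), of "-1"]] scale(2)[OF that(2), of "-1"]
    by (simp_all add: scaleC_minus_one)
qed

lemma subspace_complexI:
  assumes "0 \<in> S" and "\<And>x y. x \<in> S \<Longrightarrow> y \<in> S \<Longrightarrow> x + y \<in> S"
    and "\<And>c x. x \<in> S \<Longrightarrow> c *\<^sub>C x \<in> S"
  shows "subspace (S :: 'a::complex_vector set)"
  using assms by (simp add: subspace_def scaleR_scaleC)

lemma linear_operator_on_range:
  assumes "linear_operator_on D A"
  shows "s \<in> A ` D \<Longrightarrow> c *\<^sub>C s \<in> A ` D" "subspace (A ` D)"
proof -
  note lin = linear_operator_onD[OF assms]
  show scale: "c *\<^sub>C s \<in> A ` D" if "s \<in> A ` D" for c s
    using that lin(7,8) by (metis (no_types, lifting) image_iff)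
  show "subspace (A ` D)"
  proof (rule subspace_complexI)
    show "0 \<in> A ` D"
      using lin(1,2) by (metis image_eqI)
    show "s + t \<in> A ` D" if "s \<in> A ` D" "t \<in> A ` D" for s t
      using that lin(3,4) by (metis (no_types, lifting) image_iff)
  qed (rule scale)
qed

lemma linear_operator_on_shifted:
  assumes "linear_operator_on D A"
  shows "linear_operator_on D (\<lambda>x. A x + c *\<^sub>C x)"
  using linear_operator_onD[OF assms] unfolding linear_operator_on_def
  by (simp add: scaleC_add_right scaleC_scaleC mult.commute)

lemma selfadjoint_imp_linear: "selfadjoint_on D A \<Longrightarrow> linear_operator_on D A"
  by (simp add: selfadjoint_on_def)

text \<open>The adjoint relation puts \<open>y\<close> into the adjoint domain, which is
  \<open>D\<close>; density makes \<open>z\<close> the only possible value of the adjoint. This is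
  how membership in \<open>D\<close> is obtained throughout.\<close>

lemma selfadjoint_mem_domainI:
  assumes "selfadjoint_on D A" and "\<And>x. x \<in> D \<Longrightarrow> cinner (A x) y = cinner x z"
  shows "y \<in> D" "A y = z"
proof -
  show "y \<in> D"
    using assms unfolding selfadjoint_on_def adjoint_domain_def by blast
  then have "A y = adjoint_operator D A y"
    using assms(1) by (simp add: selfadjoint_on_def)
  also have "\<dots> = z"
    unfolding adjoint_operator_def
  proof (rule the_equality)
    fix w assume "\<forall>x\<in>D. cinner (A x) y = cinner x w"
    then show "w = z"
      using assms cinner_dense_cancel[of D w z] unfolding selfadjoint_on_def by metis
  qed (use assms(2) in blast)
  finally show "A y = z" .
qed

lemma selfadjoint_symmetric:
  assumes "selfadjoint_on D A" "x \<in> D" "y \<in> D"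
  shows "cinner (A x) y = cinner x (A y)"
proof -
  obtain z where z: "\<And>x. x \<in> D \<Longrightarrow> cinner (A x) y = cinner x z"
    using assms unfolding selfadjoint_on_def adjoint_domain_def by blast
  show ?thesis
    using selfadjoint_mem_domainI(2)[OF assms(1) z] z[OF assms(2)] by simp
qed

text \<open>Takes the place of continuity: symmetry against a fixed \<open>v\<close> survives the
  limit and becomes the adjoint relation for \<open>x\<close> and \<open>z\<close>.\<close>

lemma selfadjoint_closed_graph:
  assumes "selfadjoint_on D A" and "\<And>n. s n \<in> D" and "s \<longlonglongrightarrow> x" and "(\<lambda>n. A (s n)) \<longlonglongrightarrow> z"
  shows "x \<in> D" "A x = z"
proof -
  have *: "cinner (A v) x = cinner v z" if "v \<in> D" for v
  proof (rule LIMSEQ_unique[OF tendsto_cinner_right[OF assms(3)]])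
    show "(\<lambda>n. cinner (A v) (s n)) \<longlonglongrightarrow> cinner v z"
      using tendsto_cinner_right[OF assms(4), of v]
      by (simp add: selfadjoint_symmetric[OF assms(1) that assms(2)])
  qed
  show "x \<in> D" "A x = z"
    using selfadjoint_mem_domainI[OF assms(1) *] by blast+
qed

section \<open>The resolvent on the imaginary axis\<close>

text \<open>By symmetry \<open>cinner (A x) x\<close> is real, so \<open>A x\<close> and the
  imaginary multiple of \<open>x\<close> are orthogonal for the real inner product.\<close>

lemma norm_shifted:
  assumes "selfadjoint_on D A" "x \<in> D"
  shows "(norm (A x + (\<i> * complex_of_real a) *\<^sub>C x))\<^sup>2 =
    (norm (A x))\<^sup>2 + (norm ((\<i> * complex_of_real a) *\<^sub>C x))\<^sup>2"
proof -
  have "cinner (A x) x = cnj (cinner (A x) x)"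
    using selfadjoint_symmetric[OF assms(1,2,2)] cinner_commute by metis
  then have "Im (cinner (A x) x) = 0"
    by (simp add: complex_eq_iff)
  then have "A x \<bullet> (\<i> * complex_of_real a) *\<^sub>C x = 0"
    by (simp add: inner_eq_Re_cinner cinner_scaleC_right)
  then show ?thesis
    by (simp add: power2_norm_eq_inner inner_simps inner_commute)
qed

text \<open>The Pythagorean identity bounds the shifted operator below by \<open>a\<close>, so
  convergent images have Cauchy preimages; the closed graph identifies the limit.\<close>

lemma closed_range_shifted:
  fixes D :: "'a::complex_hilbert_space set"
  assumes sa: "selfadjoint_on D A" and "a > 0"
  shows "closed ((\<lambda>x. A x + (\<i> * complex_of_real a) *\<^sub>C x) ` D)" (is "closed (?B ` D)")
  unfolding closed_sequential_limits
proof (intro allI impI, elim conjE)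
  note lin = linear_operator_onD[OF selfadjoint_imp_linear[OF sa]]
  let ?c = "\<i> * complex_of_real a"
  fix t z assume "\<forall>n. t n \<in> ?B ` D" and t: "t \<longlonglongrightarrow> z"
  then obtain s where s: "\<And>n. s n \<in> D" "\<And>n. t n = ?B (s n)"
    unfolding image_iff Bex_def by metis
  have le: "a * dist (s m) (s n) \<le> dist (t m) (t n)" for m n
  proof -
    have "t m - t n = ?B (s m - s n)"
      by (simp add: s lin scaleC_diff_right)
    then have "(norm (t m - t n))\<^sup>2 \<ge> (a * norm (s m - s n))\<^sup>2"
      using norm_shifted[OF sa lin(5)[OF s(1) s(1)], of m n a] \<open>a > 0\<close>
      by (simp add: norm_scaleC norm_mult)
    then show ?thesis
      unfolding dist_norm by (rule power2_le_imp_le) simp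
  qed
  have "Cauchy s"
  proof (rule metric_CauchyI)
    fix e :: real assume "e > 0"
    then obtain N where "\<forall>m\<ge>N. \<forall>n\<ge>N. dist (t m) (t n) < a * e"
      using metric_CauchyD[OF LIMSEQ_imp_Cauchy[OF t], of "a * e"] \<open>a > 0\<close> by auto
    then have "\<forall>m\<ge>N. \<forall>n\<ge>N. a * dist (s m) (s n) < a * e"
      using le order_le_less_trans by blast
    then show "\<exists>M. \<forall>m\<ge>M. \<forall>n\<ge>M. dist (s m) (s n) < e"
      using \<open>a > 0\<close> by auto
  qed
  then obtain x where x: "s \<longlonglongrightarrow> x"
    using Cauchy_convergent convergent_def by blast
  have "(\<lambda>n. norm (?c *\<^sub>C s n - ?c *\<^sub>C x)) \<longlonglongrightarrow> 0"
    using tendsto_mult_right_zero[OF tendsto_norm_zero[OF LIM_zero[OF x]], of "cmod ?c"]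
    by (simp add: norm_scaleC flip: scaleC_diff_right)
  then have "(\<lambda>n. ?c *\<^sub>C s n) \<longlonglongrightarrow> ?c *\<^sub>C x"
    by (rule LIM_zero_cancel[OF tendsto_norm_zero_cancel])
  \<comment> \<open>The left side is \<open>A (s n)\<close>, whose convergence the closed graph
    lemma requires.\<close>
  then have "(\<lambda>n. t n - ?c *\<^sub>C s n) \<longlonglongrightarrow> z - ?c *\<^sub>C x"
    by (intro tendsto_diff t)
  then have "(\<lambda>n. A (s n)) \<longlonglongrightarrow> z - ?c *\<^sub>C x"
    by (simp add: s)
  from selfadjoint_closed_graph[OF sa s(1) x this] show "z \<in> ?B ` D"
    by (intro image_eqI[of _ _ x]) auto
qed

text \<open>The residual of projecting \<open>w\<close> onto the closed range would be an
  eigenvector of \<open>A\<close> for the non-real value \<open>\<i> a\<close> unless it is zero,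
  and symmetry excludes such eigenvectors.\<close>

lemma range_shifted:
  fixes D :: "'a::complex_hilbert_space set"
  assumes sa: "selfadjoint_on D A" and "a > 0"
  shows "(\<lambda>x. A x + (\<i> * complex_of_real a) *\<^sub>C x) ` D = UNIV" (is "?B ` D = UNIV")
proof -
  let ?c = "\<i> * complex_of_real a"
  note B = linear_operator_on_range[OF linear_operator_on_shifted[OF selfadjoint_imp_linear[OF sa], of ?c]]
  have "w \<in> ?B ` D" for w
  proof -
    obtain p where p: "p \<in> ?B ` D" "\<forall>s\<in>?B ` D. cinner s (w - p) = 0"
      using complex_orthogonal_projection_exists[OF closed_range_shifted[OF assms] B(2,1), of w]
      by blast
    \<comment> \<open>The sign is right because the conjugate of \<open>?c\<close> is
      \<open>- ?c\<close>.\<close>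
    have *: "cinner (A x) (w - p) = cinner x (?c *\<^sub>C (w - p))" if "x \<in> D" for x
    proof -
      have "cinner (?B x) (w - p) = 0"
        using p that by blast
      then show ?thesis
        by (simp add: cinner_add_left cinner_scaleC_left cinner_scaleC_right eq_neg_iff_add_eq_0)
    qed
    have z: "w - p \<in> D" "A (w - p) = ?c *\<^sub>C (w - p)"
      using selfadjoint_mem_domainI[OF sa *] by blast+
    have "cinner (A (w - p)) (w - p) = cinner (w - p) (A (w - p))"
      by (rule selfadjoint_symmetric[OF sa z(1,1)])
    then have "?c * cinner (w - p) (w - p) = - ?c * cinner (w - p) (w - p)"
      by (simp add: z cinner_scaleC_left cinner_scaleC_right)
    then have "w - p = 0"
      using \<open>a > 0\<close> by (simp add: cinner_self complex_eq_iff)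
    then show ?thesis
      using p(1) by simp
  qed
  then show ?thesis
    by blast
qed

text \<open>The Pythagorean identity makes the kernel of the shifted operator trivial, so
  \<open>inv_into\<close> has only one preimage to choose.\<close>

lemma shifted_inverse_eq:
  assumes sa: "selfadjoint_on D A" and "a > 0" and "x \<in> D"
    and "A x + (\<i> * complex_of_real a) *\<^sub>C x = w"
  shows "shifted_inverse D A (\<i> * complex_of_real a) w = x"
proof -
  note lin = linear_operator_onD[OF selfadjoint_imp_linear[OF sa]]
  let ?c = "\<i> * complex_of_real a"
  have "inj_on (\<lambda>x. A x + ?c *\<^sub>C x) D"
  proof (rule inj_onI)
    fix v v' assume v: "v \<in> D" "v' \<in> D" and eq: "A v + ?c *\<^sub>C v = A v' + ?c *\<^sub>C v'"
    have "A (v - v') + ?c *\<^sub>C (v - v') = (A v + ?c *\<^sub>C v) - (A v' + ?c *\<^sub>C v')"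
      by (simp add: v lin scaleC_diff_right)
    then have "A (v - v') + ?c *\<^sub>C (v - v') = 0"
      using eq by simp
    then have "(norm (A (v - v')))\<^sup>2 + (norm (?c *\<^sub>C (v - v')))\<^sup>2 = 0"
      using norm_shifted[OF sa, of "v - v'" a] v lin by simp
    then have "norm (?c *\<^sub>C (v - v')) = 0"
      by (simp add: sum_power2_eq_zero_iff)
    then show "v = v'"
      using \<open>a > 0\<close> by (simp add: norm_scaleC)
  qed
  then show ?thesis
    unfolding shifted_inverse_def assms(4)[symmetric] by (rule inv_into_f_f) fact
qed

section \<open>Null space, minimal-norm solution and closure of the range\<close>

lemma scaleC_null_space:
  assumes "linear_operator_on D A" "x \<in> null_space D A"
  shows "c *\<^sub>C x \<in> null_space D A"
  using linear_operator_onD[OF assms(1)] assms(2) scaleC_diff_right[of c 0 0] by (auto simp: null_space_def)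

lemma subspace_null_space:
  assumes "linear_operator_on D A"
  shows "subspace (null_space D A)"
  using linear_operator_onD[OF assms] scaleC_null_space[OF assms]
  by (intro subspace_complexI) (auto simp: null_space_def)

lemma closed_null_space:
  assumes "selfadjoint_on D A"
  shows "closed (null_space D A)"
  unfolding closed_sequential_limits
proof (intro allI impI, elim conjE)
  fix s x assume "\<forall>n. s n \<in> null_space D A" and x: "s \<longlonglongrightarrow> x"
  then have s: "\<And>n. s n \<in> D" "\<And>n. A (s n) = 0"
    by (auto simp: null_space_def)
  then have "(\<lambda>n. A (s n)) \<longlonglongrightarrow> 0"
    by simp
  from selfadjoint_closed_graph[OF assms s(1) x this] show "x \<in> null_space D A"
    by (simp add: null_space_def)
qed

text \<open>Justifies the definite description: subtracting from a solution its projection onto the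
  null space gives existence, and two candidates differ by a null vector orthogonal to
  itself.\<close>

lemma minimal_norm_solution:
  fixes D :: "'a::complex_hilbert_space set"
  assumes sa: "selfadjoint_on D A" and "\<exists>v\<in>D. A v = f"
  shows "minimal_norm_solution D A f \<in> D" "A (minimal_norm_solution D A f) = f"
    "orthogonal_to (minimal_norm_solution D A f) (null_space D A)"
proof -
  note lino = selfadjoint_imp_linear[OF sa]
  note lin = linear_operator_onD[OF lino]
  let ?P = "\<lambda>y. y \<in> D \<and> A y = f \<and> orthogonal_to y (null_space D A)"
  obtain v where v: "v \<in> D" "A v = f"
    using assms(2) by blast
  obtain p where p: "p \<in> null_space D A" "\<forall>s\<in>null_space D A. cinner s (v - p) = 0"
    using complex_orthogonal_projection_exists[OF closed_null_space[OF sa] subspace_null_space[OF lino]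
        scaleC_null_space[OF lino], of v] by blast
  have "cinner (v - p) s = 0" if "s \<in> null_space D A" for s
    using p(2) that cinner_commute[of "v - p" s] by simp
  then have ex: "?P (v - p)"
    using v p(1) lin by (simp add: null_space_def orthogonal_to_def)
  have uniq: "y = y'" if "?P y" "?P y'" for y y'
  proof -
    have "y - y' \<in> null_space D A"
      using that lin by (simp add: null_space_def)
    then have "cinner (y - y') (y - y') = 0"
      using that by (simp add: orthogonal_to_def cinner_diff_left)
    then show ?thesis
      by (simp add: cinner_self)
  qed
  have "?P (minimal_norm_solution D A f)"
    unfolding minimal_norm_solution_def using theI'[of ?P] ex uniq by blast
  then show "minimal_norm_solution D A f \<in> D" "A (minimal_norm_solution D A f) = f"
    "orthogonal_to (minimal_norm_solution D A f) (null_space D A)"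
    by blast+
qed

text \<open>The part of \<open>w\<close> orthogonal to the range satisfies the adjoint relation with
  value 0, hence is a null vector; it is then orthogonal to \<open>w\<close> and to
  \<open>p\<close>, so to itself.\<close>

lemma orthogonal_null_space_imp_closure_range:
  fixes D :: "'a::complex_hilbert_space set"
  assumes sa: "selfadjoint_on D A" and w: "orthogonal_to w (null_space D A)"
  shows "w \<in> closure (A ` D)"
proof -
  note range = linear_operator_on_range[OF selfadjoint_imp_linear[OF sa]]
  obtain p where p: "p \<in> closure (A ` D)" "\<forall>s\<in>closure (A ` D). s \<bullet> (w - p) = 0"
    using orthogonal_projection_exists[OF closed_closure subspace_closure[OF range(2)]] by blast
  have *: "cinner (A x) (w - p) = cinner x 0" if "x \<in> D" for x
  proof -
    have "cinner (A x) (w - p) = 0"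
    proof (rule cinner_eq_zeroI)
      show "c *\<^sub>C s \<in> A ` D" if "s \<in> A ` D" for c s
        using that by (rule range(1))
      show "s \<bullet> (w - p) = 0" if "s \<in> A ` D" for s
        using p(2) that closure_subset by blast
      show "A x \<in> A ` D"
        using that by blast
    qed
    then show ?thesis
      by simp
  qed
  have "w - p \<in> null_space D A"
    using selfadjoint_mem_domainI[OF sa *] by (simp add: null_space_def)
  then have "w \<bullet> (w - p) = 0"
    using w by (simp add: orthogonal_to_def inner_eq_Re_cinner)
  moreover have "p \<bullet> (w - p) = 0"
    using p by blast
  ultimately have "(w - p) \<bullet> (w - p) = 0"
    by (simp add: inner_diff_left)
  then show ?thesis
    using p(1) by simp
qed

section \<open>Powers of a contraction satisfying the Pythagorean identity\<close>

lemma pythagorean_contraction_powers_tendsto_zero: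
  fixes L :: "'a::real_inner \<Rightarrow> 'a"
  assumes diff: "\<And>x y. L (x - y) = L x - L y"
    and pyth: "\<And>x. (norm x)\<^sup>2 = (norm (L x))\<^sup>2 + (norm (x - L x))\<^sup>2"
    and w: "w \<in> closure (range (\<lambda>x. x - L x))"
  shows "(\<lambda>n. (L ^^ n) w) \<longlonglongrightarrow> 0"
proof -
  have pow_diff: "(L ^^ n) (x - y) = (L ^^ n) x - (L ^^ n) y" for n x y
    by (induction n) (simp_all add: diff)
  have le: "norm (L x) \<le> norm x" for x
    using pyth[of x] by (simp add: norm_le power2_norm_eq_inner)
  have pow_le: "norm ((L ^^ n) x) \<le> norm x" for n x
  proof (induction n)
    case (Suc n)
    show ?case
      using order_trans[OF le Suc] by simp
  qed simp
  have range: "(\<lambda>n. (L ^^ n) (x - L x)) \<longlonglongrightarrow> 0" for x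
  proof -
    let ?b = "\<lambda>n. (norm ((L ^^ n) x))\<^sup>2"
    \<comment> \<open>The Pythagorean identity at \<open>(L ^^ n) x\<close>, with \<open>L\<close>
      commuted past its powers; the right side telescopes.\<close>
    have eq: "(norm ((L ^^ n) (x - L x)))\<^sup>2 = ?b n - ?b (Suc n)" for n
      using pyth[of "(L ^^ n) x"] by (simp add: pow_diff funpow_swap1)
    have "decseq ?b"
    proof (rule decseq_SucI)
      show "?b (Suc n) \<le> ?b n" for n
        using eq[of n] zero_le_power2[of "norm ((L ^^ n) (x - L x))"] by linarith
    qed
    then obtain l where l: "?b \<longlonglongrightarrow> l"
      using decseq_convergent[of ?b 0] by auto
    have "(\<lambda>n. ?b n - ?b (Suc n)) \<longlonglongrightarrow> l - l"
      by (intro tendsto_diff l LIMSEQ_Suc)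
    then have "(\<lambda>n. (norm ((L ^^ n) (x - L x)))\<^sup>2) \<longlonglongrightarrow> 0"
      by (simp only: eq diff_self)
    then have "(\<lambda>n. sqrt ((norm ((L ^^ n) (x - L x)))\<^sup>2)) \<longlonglongrightarrow> sqrt 0"
      by (rule tendsto_real_sqrt)
    then show ?thesis
      by (simp add: tendsto_norm_zero_iff)
  qed
  show ?thesis
  proof (rule LIMSEQ_I)
    fix e :: real assume "e > 0"
    \<comment> \<open>Powers of \<open>L\<close> do not enlarge the approximation error, so one
      \<open>x\<close> serves for all \<open>n\<close>.\<close>
    then obtain x where x: "dist (x - L x) w < e / 2"
      using w closure_approachable[of w] by (metis (no_types, lifting) half_gt_zero imageE)
    obtain N where N: "\<And>n. n \<ge> N \<Longrightarrow> norm ((L ^^ n) (x - L x)) < e / 2"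
      using LIMSEQ_D[OF range, of "e / 2" x] \<open>e > 0\<close> by auto
    have "norm ((L ^^ n) w - 0) < e" if "n \<ge> N" for n
    proof -
      have "(L ^^ n) w = (L ^^ n) (w - (x - L x)) + (L ^^ n) (x - L x)"
        by (simp add: pow_diff)
      then have "norm ((L ^^ n) w) \<le> norm (w - (x - L x)) + norm ((L ^^ n) (x - L x))"
        using norm_triangle_le[OF add_right_mono[OF pow_le]] by metis
      then show ?thesis
        using N[OF that] x by (simp add: dist_norm norm_minus_commute)
    qed
    then show "\<exists>N. \<forall>n\<ge>N. norm ((L ^^ n) w - 0) < e"
      by blast
  qed
qed

section \<open>Convergence of the iteration\<close>

theorem theorem4:
  fixes D :: "'a::complex_hilbert_space set" and A L :: "'a \<Rightarrow> 'a"
    and a :: real and f g y :: 'a and u :: "nat \<Rightarrow> 'a"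
  assumes "selfadjoint_on D A"
    and "a > 0"
    and "\<exists>v\<in>D. A v = f"
    and "y = minimal_norm_solution D A f"
    and "L = (\<lambda>x. (\<i> * complex_of_real a) *\<^sub>C shifted_inverse D A (\<i> * complex_of_real a) x)"
    and "g = shifted_inverse D A (\<i> * complex_of_real a) f"
    and "orthogonal_to (u 1) (null_space D A)"
    and "\<And>n. n \<ge> 1 \<Longrightarrow> u (n + 1) = L (u n) + g"
  shows "(\<lambda>n. norm (u n - y)) \<longlonglongrightarrow> 0"
proof -
  note sa = assms(1)
  note lin = linear_operator_onD[OF selfadjoint_imp_linear[OF sa]]
  let ?c = "\<i> * complex_of_real a"
  let ?R = "shifted_inverse D A ?c"
  have R: "?R (A x + ?c *\<^sub>C x) = x" if "x \<in> D" for x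
    using shifted_inverse_eq[OF sa assms(2) that refl] .
  \<comment> \<open>Writing vectors as \<open>A v + ?c *\<^sub>C v\<close> turns each claim about
    the resolvent into a computation in \<open>D\<close>.\<close>
  have ex: "\<exists>v\<in>D. x = A v + ?c *\<^sub>C v" for x
    using range_shifted[OF sa assms(2)] by (metis (no_types, lifting) UNIV_I imageE)
  have Rdiff: "?R (x - z) = ?R x - ?R z" for x z
  proof -
    obtain v v' where v: "v \<in> D" "x = A v + ?c *\<^sub>C v" "v' \<in> D" "z = A v' + ?c *\<^sub>C v'"
      using ex by metis
    then have "x - z = A (v - v') + ?c *\<^sub>C (v - v')"
      using lin by (simp add: scaleC_diff_right)
    then show ?thesis
      using v lin R by metis
  qed
  have L: "L (A v + ?c *\<^sub>C v) = ?c *\<^sub>C v" if "v \<in> D" for v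
    using R[OF that] by (simp add: assms(5))
  have Ldiff: "L (x - z) = L x - L z" for x z
    by (simp add: assms(5) Rdiff scaleC_diff_right)
  have pyth: "(norm x)\<^sup>2 = (norm (L x))\<^sup>2 + (norm (x - L x))\<^sup>2" for x
  proof -
    obtain v where v: "v \<in> D" "x = A v + ?c *\<^sub>C v"
      using ex by blast
    then have "L x = ?c *\<^sub>C v"
      using L by blast
    then show ?thesis
      using norm_shifted[OF sa v(1), of a] v(2) by simp
  qed
  have AD: "A ` D \<subseteq> range (\<lambda>x. x - L x)"
  proof (rule image_subsetI)
    fix v assume "v \<in> D"
    then show "A v \<in> range (\<lambda>x. x - L x)"
      using L by (intro image_eqI[of _ _ "A v + ?c *\<^sub>C v"]) auto
  qed
  have y: "y \<in> D" "A y = f" "orthogonal_to y (null_space D A)"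
    using minimal_norm_solution[OF sa assms(3)] by (simp_all add: assms(4))
  \<comment> \<open>Apply the resolvent to \<open>f\<close>, written as
    \<open>(A y + ?c *\<^sub>C y) - ?c *\<^sub>C y\<close>: this gives
    \<open>g = y - L y\<close>.\<close>
  have fix_y: "L y + g = y"
  proof -
    have "g = ?R ((A y + ?c *\<^sub>C y) - ?c *\<^sub>C y)"
      using y(2) by (simp add: assms(6))
    also have "\<dots> = y - ?R (?c *\<^sub>C y)"
      unfolding Rdiff R[OF y(1)] ..
    \<comment> \<open>The scalar stands inside the resolvent here but outside in \<open>L\<close>;
      passing to the preimage \<open>v\<close> of \<open>y\<close> moves it across.\<close>
    also have "?R (?c *\<^sub>C y) = L y"
    proof -
      obtain v where v: "v \<in> D" "y = A v + ?c *\<^sub>C v"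
        using ex by blast
      have "?c *\<^sub>C y = A (?c *\<^sub>C v) + ?c *\<^sub>C (?c *\<^sub>C v)"
        using v lin by (simp add: scaleC_add_right)
      then have "?R (?c *\<^sub>C y) = ?c *\<^sub>C v"
        using R lin v by metis
      then show ?thesis
        using L v by simp
    qed
    finally show ?thesis
      by simp
  qed
  \<comment> \<open>The recursion starts at index 1, hence \<open>n\<close> powers of
    \<open>L\<close> at index \<open>Suc n\<close>; \<open>u 0\<close> is unconstrained.\<close>
  have iter: "u (Suc n) - y = (L ^^ n) (u 1 - y)" for n
  proof (induction n)
    case (Suc n)
    have "u (Suc (Suc n)) - y = (L (u (Suc n)) + g) - (L y + g)"
      using assms(8)[of "Suc n"] fix_y by simp
    also have "\<dots> = L (u (Suc n) - y)"
      by (simp add: Ldiff)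
    finally show ?case
      using Suc by simp
  qed simp
  \<comment> \<open>\<open>L\<close> fixes every null vector, so a null component of the initial
    error would never decay.\<close>
  have "orthogonal_to (u 1 - y) (null_space D A)"
    using assms(7) y(3) by (simp add: orthogonal_to_def cinner_diff_left)
  then have "u 1 - y \<in> closure (range (\<lambda>x. x - L x))"
    using orthogonal_null_space_imp_closure_range[OF sa] closure_mono[OF AD] by blast
  then have "(\<lambda>n. u (Suc n) - y) \<longlonglongrightarrow> 0"
    unfolding iter by (rule pythagorean_contraction_powers_tendsto_zero[OF Ldiff pyth])
  then show ?thesis
    by (intro tendsto_norm_zero) (rule LIMSEQ_imp_Suc)
qed

end
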